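(* Let $A=(a_{ij})$ be a real $n\times n$ matrix satisfying $$a_{ii} \geq a_{i,i+1} \geq \dots \geq a_{in} \geq a_{i1} \geq \dots \geq a_{i,i-1}, \qquad i=1,\dots,n.$$ Suppose that the directed graph $\mathscr{G}(A)$ has exactly one closed strongly connected component and that the system $A^{\top}x=e$ has a solution $x\in\mathbb{R}^n$, where $e$ is the vector of all ones. Then either $x\geq 0$ and $\det A>0$, or $x\leq 0$ and $\det A<0$.
   Context: Vector inequalities are component-wise. The directed graph $\mathscr{G}(A)$ has vertex set $\{1,\dots,n\}$ and a directed edge from $i$ to $j$ if and only if $\kappa_{ij}=1$, where $\kappa_{ij}:=1$ if ($j=1$ and $a_{in}>a_{i1}$) or ($2\leq j\leq n$ and $a_{i,j-1}>a_{ij}$), and $\kappa_{ij}:=0$ otherwise. Two distinct vertices $i,j$ are strongly connected if there are directed paths in $\mathscr{G}(A)$ from $i$ to $j$ and from $j$ to $i$; every vertex is declared strongly connected to itself. The equivalence classes of this relation are the strongly connected components (SCCs). An SCC $C$ is open if there is a directed edge from a vertex in $C$ to a vertex not in $C$, and closed otherwise. *)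

theory Defs
  imports "Jordan_Normal_Form.Determinant" "Graph_Theory.Digraph_Component"
begin

(* Rows, columns and vertices are numbered 0, ..., n-1 instead of 1, ..., n. *)

(* Row i, read cyclically from the diagonal entry to the right, is non-increasing:
   a(i,i) >= a(i,i+1) >= ... >= a(i,n-1) >= a(i,0) >= ... >= a(i,i-1). *)
definition cyclically_nonincreasing_rows :: "real mat \<Rightarrow> bool" where
  "cyclically_nonincreasing_rows A \<longleftrightarrow>
     (\<forall>i < dim_row A. sorted_wrt (\<ge>) (map (\<lambda>j. A $$ (i, j)) ([i..<dim_col A] @ [0..<i])))"

definition matrix_digraph :: "real mat \<Rightarrow> nat pair_pre_digraph" where
  "matrix_digraph A =
     \<lparr> pverts = {..<dim_row A},
       parcs = {(i, j). i < dim_row A \<and> j < dim_row A \<and>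
                  (if j = 0 then A $$ (i, dim_col A - 1) > A $$ (i, 0)
                   else A $$ (i, j - 1) > A $$ (i, j))} \<rparr>"

definition open_scc :: "('a, 'b) pre_digraph \<Rightarrow> 'a set \<Rightarrow> bool" where
  "open_scc G C \<longleftrightarrow> C \<in> pre_digraph.sccs_verts G \<and>
     (\<exists>u \<in> C. \<exists>v \<in> verts G - C. u \<rightarrow>\<^bsub>G\<^esub> v)"

definition closed_scc :: "('a, 'b) pre_digraph \<Rightarrow> 'a set \<Rightarrow> bool" where
  "closed_scc G C \<longleftrightarrow> C \<in> pre_digraph.sccs_verts G \<and> \<not> open_scc G C"

lemma wf_matrix_digraph: "wf_digraph (with_proj (matrix_digraph A))"
  by unfold_locales (auto simp: matrix_digraph_def)

(* The library's component vertex sets are the equivalence classes of mutual reachability,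
   where every vertex is by definition equivalent to itself. *)
lemma (in wf_digraph) sccs_verts_eq_quotient:
  "sccs_verts = verts G // {(u, v). u \<in> verts G \<and> v \<in> verts G \<and>
     (u = v \<or> u \<rightarrow>\<^sup>*\<^bsub>G\<^esub> v \<and> v \<rightarrow>\<^sup>*\<^bsub>G\<^esub> u)}" (is "_ = _ // ?R")
proof (intro Set.set_eqI iffI)
  fix S assume S: "S \<in> sccs_verts"
  then obtain u where u: "u \<in> S" by (auto simp: sccs_verts_def)
  have mem: "v \<in> S \<longleftrightarrow> u \<rightarrow>\<^sup>*\<^bsub>G\<^esub> v \<and> v \<rightarrow>\<^sup>*\<^bsub>G\<^esub> u" for v
    using S u by (auto simp: sccs_verts_def)
  have "u \<in> verts G" using mem u by (auto intro: reachable_in_verts)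
  moreover have "S = ?R `` {u}"
    using mem u by (auto intro: reachable_in_verts)
  ultimately show "S \<in> verts G // ?R" by (auto simp: quotient_def)
next
  fix S assume "S \<in> verts G // ?R"
  then obtain u where u: "u \<in> verts G" and S: "S = ?R `` {u}" by (auto simp: quotient_def)
  have mem: "v \<in> S \<longleftrightarrow> u \<rightarrow>\<^sup>*\<^bsub>G\<^esub> v \<and> v \<rightarrow>\<^sup>*\<^bsub>G\<^esub> u" for v
    using S u by (auto intro: reachable_in_verts)
  show "S \<in> sccs_verts" unfolding sccs_verts_def
    using u mem by (blast intro: reachable_trans reachable_refl)
qed

end

theory Submission
  imports Defs
begin

text \<open>
  The cyclic column differences \<open>b i j = a(i,j-1) - a(i,j)\<close> form the generator matrix of a Markov
  chain whose transition graph is the digraph of \<open>A\<close>: nonnegative off the diagonal, with zero row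
  sums. Since all column sums of \<open>diag(x) A\<close> equal 1, the vector \<open>x\<close> annihilates \<open>b\<close> from the left,
  so the supports of its positive and negative parts are closed under outgoing edges; each would
  contain a closed component, hence one of them is empty.
  If all entries of \<open>A\<close> are positive, the maximum principle for \<open>b\<close>, applied to the partial sums of
  a kernel vector, shows that \<open>A\<close> is invertible, and the segment from \<open>A\<close> to the identity shows
  \<open>det A > 0\<close>. The general case follows from \<open>det (A + t J) = (1 + t (\<Sum>i. x i)) det A\<close>, with \<open>J\<close>
  the all-ones matrix and \<open>t\<close> large, because adding \<open>t J\<close> does not change \<open>b\<close>.
\<close>

section \<open>Generators with a unique closed class\<close>

definition out_closed :: "nat \<Rightarrow> (nat \<Rightarrow> nat \<Rightarrow> real) \<Rightarrow> nat set \<Rightarrow> bool" where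
  "out_closed n b S \<longleftrightarrow> S \<subseteq> {..<n} \<and> (\<forall>i \<in> S. \<forall>j < n. b i j > 0 \<longrightarrow> j \<in> S)"

text \<open>The last clause states uniqueness of the closed class without mentioning components. In
  this form it passes at once to a generator with more edges.\<close>

definition unichain_generator :: "nat \<Rightarrow> (nat \<Rightarrow> nat \<Rightarrow> real) \<Rightarrow> bool" where
  "unichain_generator n b \<longleftrightarrow>
     (\<forall>i < n. \<forall>j < n. i \<noteq> j \<longrightarrow> b i j \<ge> 0) \<and>
     (\<forall>i < n. (\<Sum>j<n. b i j) = 0) \<and>
     (\<forall>S T. out_closed n b S \<longrightarrow> out_closed n b T \<longrightarrow> S \<noteq> {} \<longrightarrow> T \<noteq> {} \<longrightarrow> S \<inter> T \<noteq> {})"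

lemma unichain_generator_offdiag_nonneg:
  "unichain_generator n b \<Longrightarrow> i < n \<Longrightarrow> j < n \<Longrightarrow> i \<noteq> j \<Longrightarrow> b i j \<ge> 0"
  by (simp add: unichain_generator_def)

lemma unichain_generator_row_sum:
  "unichain_generator n b \<Longrightarrow> i < n \<Longrightarrow> (\<Sum>j<n. b i j) = 0"
  by (simp add: unichain_generator_def)

lemma unichain_generator_meet:
  "unichain_generator n b \<Longrightarrow> out_closed n b S \<Longrightarrow> out_closed n b T \<Longrightarrow> S \<noteq> {} \<Longrightarrow> T \<noteq> {} \<Longrightarrow>
     S \<inter> T \<noteq> {}"
  by (simp add: unichain_generator_def)

text \<open>Extra edges can only destroy closed sets: every set closed for \<open>c\<close> is
  closed for \<open>b\<close>, so the intersection property is inherited.\<close>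

lemma unichain_generator_mono:
  assumes b: "unichain_generator n b"
    and c: "\<And>i j. i < n \<Longrightarrow> j < n \<Longrightarrow> i \<noteq> j \<Longrightarrow> c i j \<ge> 0"
    and sum: "\<And>i. i < n \<Longrightarrow> (\<Sum>j<n. c i j) = 0"
    and pos: "\<And>i j. i < n \<Longrightarrow> j < n \<Longrightarrow> i \<noteq> j \<Longrightarrow> b i j > 0 \<Longrightarrow> c i j > 0"
  shows "unichain_generator n c"
proof -
  have closed: "out_closed n b S" if "out_closed n c S" for S
    unfolding out_closed_def
  proof (intro conjI ballI allI impI)
    show "S \<subseteq> {..<n}" using that by (simp add: out_closed_def)
    fix i j assume "i \<in> S" "j < n" "b i j > 0"
    then show "j \<in> S"
      using that pos[of i j] by (cases "i = j") (auto simp: out_closed_def)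
  qed
  show ?thesis
    unfolding unichain_generator_def
    using c sum unichain_generator_meet[OF b] closed by blast
qed

text \<open>Minimum principle: where \<open>z i\<close> equals the lower bound, all summands are
  nonnegative and add up to 0, so \<open>z j = z i\<close> along every edge leaving
  \<open>i\<close>.\<close>

lemma out_closed_argmin:
  assumes b: "unichain_generator n b"
    and z: "\<And>i. i < n \<Longrightarrow> (\<Sum>j<n. (z j - z i) * b i j) = 0"
    and m: "\<And>j. j < n \<Longrightarrow> m \<le> z j"
  shows "out_closed n b {i. i < n \<and> z i = m}"
  unfolding out_closed_def
proof (intro conjI ballI allI impI)
  fix i j assume i: "i \<in> {i. i < n \<and> z i = m}" and j: "j < n" and pos: "b i j > 0"
  have nn: "(z k - z i) * b i k \<ge> 0" if "k < n" for k
    using i m[OF that] unichain_generator_offdiag_nonneg[OF b, of i k] that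
    by (cases "k = i") auto
  have "(\<Sum>k<n. (z k - z i) * b i k) = 0" by (rule z) (use i in simp)
  then have "(z j - z i) * b i j = 0"
    using j nn by (subst (asm) sum_nonneg_eq_0_iff) auto
  then show "j \<in> {i. i < n \<and> z i = m}" using i j pos by auto
qed auto

text \<open>The minimisers and the maximisers of \<open>z\<close> both form nonempty closed sets.
  These meet, so minimum and maximum coincide.\<close>

lemma unichain_generator_harmonic_const:
  assumes b: "unichain_generator n b"
    and z: "\<And>i. i < n \<Longrightarrow> (\<Sum>j<n. (z j - z i) * b i j) = 0"
    and ij: "i < n" "j < n"
  shows "z i = z j"
proof -
  let ?m = "Min (z ` {..<n})" and ?M = "Max (z ` {..<n})"
  have ne: "z ` {..<n} \<noteq> {}" using ij by auto
  have m: "?m \<le> z k" and M: "z k \<le> ?M" if "k < n" for k using that by auto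
  have "?m \<in> z ` {..<n}" "?M \<in> z ` {..<n}" using ne by (auto intro!: Min_in Max_in)
  then have ne': "{k. k < n \<and> z k = ?m} \<noteq> {}" "{k. k < n \<and> - z k = - ?M} \<noteq> {}" by force+
  have 1: "out_closed n b {k. k < n \<and> z k = ?m}"
    by (rule out_closed_argmin[OF b z m])
  \<comment> \<open>Maximisers of \<open>z\<close> are handled as minimisers of
    \<open>- z\<close>.\<close>
  have "(\<Sum>j<n. (- z j - - z i) * b i j) = 0" if "i < n" for i
  proof -
    have "(\<Sum>j<n. (- z j - - z i) * b i j) = - (\<Sum>j<n. (z j - z i) * b i j)"
      unfolding sum_negf[symmetric] by (intro sum.cong) (auto simp: algebra_simps)
    then show ?thesis using z[OF that] by simp
  qed
  then have 2: "out_closed n b {k. k < n \<and> - z k = - ?M}"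
    by (rule out_closed_argmin[OF b]) (use M in auto)
  have "?m = ?M"
    using unichain_generator_meet[OF b 1 2 ne'] by auto
  then show ?thesis using m[OF ij(1)] M[OF ij(1)] m[OF ij(2)] M[OF ij(2)] by linarith
qed

text \<open>Let \<open>p\<close> be the positive part of \<open>x\<close>. Each column sum of
  \<open>p i * b i j\<close> is nonnegative: it dominates the one for \<open>x\<close> if
  \<open>x j > 0\<close>, and has only nonnegative terms otherwise. Zero row sums make the total 0,
  so every column sum vanishes. In a column outside the support each term then vanishes, so no edge
  leaves the support.\<close>

lemma out_closed_pos_support:
  assumes b: "unichain_generator n b"
    and x: "\<And>j. j < n \<Longrightarrow> (\<Sum>i<n. x i * b i j) = 0"
  shows "out_closed n b {i. i < n \<and> x i > 0}"
  unfolding out_closed_def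
proof (intro conjI ballI allI impI)
  define p where "p i = max (x i) 0" for i
  have step: "p i * b i j \<ge> 0 \<and> p i * b i j \<ge> x i * b i j" if "i < n" "j < n" "i \<noteq> j" for i j
    using unichain_generator_offdiag_nonneg[OF b that]
    by (auto simp: p_def intro: mult_right_mono mult_nonneg_nonneg)
  have nn: "(\<Sum>i<n. p i * b i j) \<ge> 0" if j: "j < n" for j
  proof (cases "x j > 0")
    case True
    have "(\<Sum>i<n. x i * b i j) \<le> (\<Sum>i<n. p i * b i j)"
    proof (rule sum_mono)
      fix i assume "i \<in> {..<n}"
      then show "x i * b i j \<le> p i * b i j"
        using step[of i j] j True by (cases "i = j") (auto simp: p_def)
    qed
    then show ?thesis using x[OF j] by simp
  next
    case False
    show ?thesis
    proof (rule sum_nonneg)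
      fix i assume "i \<in> {..<n}"
      then show "p i * b i j \<ge> 0"
        using step[of i j] j False by (cases "i = j") (auto simp: p_def)
    qed
  qed
  have "(\<Sum>j<n. \<Sum>i<n. p i * b i j) = (\<Sum>i<n. p i * (\<Sum>j<n. b i j))"
    by (subst sum.swap) (simp add: sum_distrib_left)
  also have "\<dots> = 0" using unichain_generator_row_sum[OF b] by simp
  finally have p0: "(\<Sum>i<n. p i * b i j) = 0" if "j < n" for j
    using that nn by (subst (asm) sum_nonneg_eq_0_iff) auto
  fix i j assume i: "i \<in> {i. i < n \<and> x i > 0}" and j: "j < n" and pos: "b i j > 0"
  show "j \<in> {i. i < n \<and> x i > 0}"
  proof (rule ccontr)
    assume "j \<notin> {i. i < n \<and> x i > 0}"
    then have xj: "p j = 0" using j by (simp add: p_def)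
    have "p i * b i j = 0"
    proof -
      have "\<forall>k \<in> {..<n}. p k * b k j \<ge> 0"
        using step[of _ j] j xj by (metis lessThan_iff mult_zero_left order_refl)
      then show ?thesis using p0[OF j] i by (subst (asm) sum_nonneg_eq_0_iff) auto
    qed
    then show False using i pos by (auto simp: p_def)
  qed
qed auto

text \<open>The positive supports of \<open>x\<close> and \<open>- x\<close> are closed and
  disjoint, so one of them is empty.\<close>

lemma unichain_generator_left_kernel_sign:
  assumes b: "unichain_generator n b"
    and x: "\<And>j. j < n \<Longrightarrow> (\<Sum>i<n. x i * b i j) = 0"
  shows "(\<forall>i<n. x i \<ge> 0) \<or> (\<forall>i<n. x i \<le> 0)"
proof -
  have "(\<Sum>i<n. - x i * b i j) = 0" if "j < n" for j
    using x[OF that] by (simp add: sum_negf)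
  from out_closed_pos_support[OF b this]
  have "out_closed n b {i. i < n \<and> - x i > 0}" .
  from unichain_generator_meet[OF b out_closed_pos_support[OF b x] this]
  show ?thesis by (force simp: not_le)
qed

section \<open>Closed components\<close>

lemma (in wf_digraph) closed_scc_subset_if_closed:
  assumes S: "S \<subseteq> verts G" "finite S" "S \<noteq> {}"
    and closed: "\<And>u v. u \<in> S \<Longrightarrow> u \<rightarrow>\<^bsub>G\<^esub> v \<Longrightarrow> v \<in> S"
  shows "\<exists>C \<subseteq> S. closed_scc G C"
proof -
  define R where "R u = {v. u \<rightarrow>\<^sup>*\<^bsub>G\<^esub> v}" for u
  have RS: "R u \<subseteq> S" if "u \<in> S" for u
  proof
    fix v assume "v \<in> R u"
    then have "u \<rightarrow>\<^sup>*\<^bsub>G\<^esub> v" by (simp add: R_def)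
    then show "v \<in> S" using that
      by (induction rule: reachable_induct) (auto intro: closed)
  qed
  \<comment> \<open>With a smallest reachable set, every vertex reachable from \<open>u\<close> has
    the same reachable set as \<open>u\<close>. Hence \<open>R u\<close> is a component that no edge
    leaves.\<close>
  obtain u where u: "u \<in> S" and min: "\<And>v. v \<in> S \<Longrightarrow> card (R u) \<le> card (R v)"
    using ex_has_least_nat[of "\<lambda>u. u \<in> S" _ "\<lambda>u. card (R u)"] S(3) by blast
  have eq: "R v = R u" if "v \<in> R u" for v
  proof (rule card_seteq)
    show "finite (R u)" using RS[OF u] S(2) by (rule finite_subset)
    show "R v \<subseteq> R u" using that by (auto simp: R_def intro: reachable_trans)
    show "card (R u) \<le> card (R v)" using min RS[OF u] that by blast
  qed
  have uR: "u \<in> R u" using u S(1) by (auto simp: R_def)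
  have reach: "v \<rightarrow>\<^sup>*\<^bsub>G\<^esub> w" if "v \<in> R u" "w \<in> R u" for v w
    using eq[OF that(1)] that(2) by (auto simp: R_def)
  have out: "w \<in> R u" if "v \<in> R u" "v \<rightarrow>\<^sup>*\<^bsub>G\<^esub> w" for v w
    using eq[OF that(1)] that(2) by (auto simp: R_def)
  have "R u \<in> sccs_verts"
    unfolding sccs_verts_def using uR reach out by blast
  moreover have "\<not> open_scc G (R u)"
    unfolding open_scc_def using out by blast
  ultimately show ?thesis using RS[OF u] unfolding closed_scc_def by blast
qed

section \<open>Cyclic differences\<close>

definition cyclic_drop :: "real mat \<Rightarrow> nat \<Rightarrow> nat \<Rightarrow> real" where
  "cyclic_drop A i j = A $$ (i, if j = 0 then dim_col A - 1 else j - 1) - A $$ (i, j)"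

text \<open>Abel summation along a row. The wrap-around term at \<open>j = 0\<close> accounts for
  the \<open>z 0\<close> in the boundary term.\<close>

lemma sum_cyclic_drop_mult:
  assumes A: "A \<in> carrier_mat n n" and n: "n > 0"
  shows "(\<Sum>j<n. A $$ (i, j) * (z (Suc j) - z j))
         = A $$ (i, n - 1) * (z n - z 0) + (\<Sum>j<n. z j * cyclic_drop A i j)"
proof -
  obtain m where m: "n = Suc m" using n by (cases n) auto
  have dim: "dim_col A = Suc m" using A m by auto
  \<comment> \<open>The upper limit \<open>k\<close> varies while the wrap-around column stays at
    \<open>m\<close>, which makes the identity provable by induction.\<close>
  have "(\<Sum>j<Suc k. A $$ (i, j) * (z (Suc j) - z j))
        = A $$ (i, k) * z (Suc k) - A $$ (i, m) * z 0 + (\<Sum>j<Suc k. z j * cyclic_drop A i j)"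
    for k
    by (induction k) (auto simp: cyclic_drop_def dim algebra_simps)
  from this[of m] show ?thesis by (simp add: m algebra_simps)
qed

lemma sum_cyclic_drop:
  assumes A: "A \<in> carrier_mat n n"
  shows "(\<Sum>j<n. cyclic_drop A i j) = 0"
  using sum_cyclic_drop_mult[OF A, of i "\<lambda>_. 1"] by (cases "n = 0") auto

text \<open>The row condition orders every cyclically adjacent pair of columns except the one ending
  at the diagonal. The cases are: right of the diagonal, the wrap from last to first column, and
  left of the diagonal.\<close>

lemma cyclic_drop_nonneg:
  assumes A: "A \<in> carrier_mat n n" and cyc: "cyclically_nonincreasing_rows A"
    and ij: "i < n" "j < n" "i \<noteq> j"
  shows "cyclic_drop A i j \<ge> 0"
proof -
  let ?f = "\<lambda>j. A $$ (i, j)"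
  have s: "sorted_wrt (\<lambda>x y. ?f x \<ge> ?f y) ([i..<n] @ [0..<i])"
    using A cyc ij by (simp add: cyclically_nonincreasing_rows_def sorted_wrt_map del: map_append)
  then have s1: "sorted_wrt (\<lambda>x y. ?f x \<ge> ?f y) [i..<n]"
    and s2: "sorted_wrt (\<lambda>x y. ?f x \<ge> ?f y) [0..<i]"
    and s3: "\<And>x y. x \<in> {i..<n} \<Longrightarrow> y < i \<Longrightarrow> ?f x \<ge> ?f y"
    by (auto simp: sorted_wrt_append)
  consider "j > i" | "j = 0" "i > 0" | "0 < j" "j < i" using ij by linarith
  then show ?thesis
  proof cases
    case 1
    then have "?f (j - 1) \<ge> ?f j"
      using sorted_wrt_nth_less[OF s1, of "j - 1 - i" "j - i"] ij by simp
    then show ?thesis using 1 by (simp add: cyclic_drop_def)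
  next
    case 2
    then show ?thesis using s3[of "n - 1" 0] ij A by (simp add: cyclic_drop_def)
  next
    case 3
    then have "?f (j - 1) \<ge> ?f j"
      using sorted_wrt_nth_less[OF s2, of "j - 1" "j"] ij by simp
    then show ?thesis using 3 by (simp add: cyclic_drop_def)
  qed
qed

text \<open>Positive drops are exactly the edges, so every nonempty \<open>out_closed\<close> set
  contains a closed component. By uniqueness any two such sets share it.\<close>

lemma unichain_generator_cyclic_drop:
  assumes A: "A \<in> carrier_mat n n" and cyc: "cyclically_nonincreasing_rows A"
    and uniq: "\<exists>!C. closed_scc (with_proj (matrix_digraph A)) C"
  shows "unichain_generator n (cyclic_drop A)"
proof -
  interpret G: wf_digraph "with_proj (matrix_digraph A)" by (rule wf_matrix_digraph)
  have adj: "u \<rightarrow>\<^bsub>with_proj (matrix_digraph A)\<^esub> v \<longleftrightarrow> u < n \<and> v < n \<and> cyclic_drop A u v > 0" for u v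
    using A by (auto simp: matrix_digraph_def cyclic_drop_def arcs_ends_def arc_to_ends_def)
  have sub: "\<exists>C \<subseteq> S. closed_scc (with_proj (matrix_digraph A)) C"
    if "out_closed n (cyclic_drop A) S" "S \<noteq> {}" for S
  proof (rule G.closed_scc_subset_if_closed)
    show "S \<subseteq> verts (with_proj (matrix_digraph A))"
      using that A by (auto simp: out_closed_def matrix_digraph_def)
    show "finite S" using that by (auto simp: out_closed_def intro: finite_subset)
    show "v \<in> S" if "u \<in> S" "u \<rightarrow>\<^bsub>with_proj (matrix_digraph A)\<^esub> v" for u v
      using \<open>out_closed n (cyclic_drop A) S\<close> that unfolding adj out_closed_def by blast
  qed (rule that)
  have "S \<inter> T \<noteq> {}"
    if ST: "out_closed n (cyclic_drop A) S" "out_closed n (cyclic_drop A) T" "S \<noteq> {}" "T \<noteq> {}" for S T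
  proof -
    obtain C where "C \<subseteq> S" "C \<subseteq> T" "closed_scc (with_proj (matrix_digraph A)) C"
      using sub[OF ST(1,3)] sub[OF ST(2,4)] uniq by (auto elim: ex1E)
    moreover from this have "C \<noteq> {}" by (auto simp: closed_scc_def G.in_sccs_verts_conv_reachable)
    ultimately show ?thesis by blast
  qed
  then show ?thesis
    unfolding unichain_generator_def
    using cyclic_drop_nonneg[OF A cyc] sum_cyclic_drop[OF A] by blast
qed

section \<open>Sign of the determinant\<close>

text \<open>Writing \<open>y\<close> as the increments of its partial sums splits
  \<open>A *\<^sub>v y\<close> into a multiple of the total sum and the generator applied to the
  partial sums.\<close>

lemma mult_mat_vec_cyclic_drop:
  assumes A: "A \<in> carrier_mat n n" and y: "y \<in> carrier_vec n" and i: "i < n"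
  shows "(A *\<^sub>v y) $ i = A $$ (i, n - 1) * (\<Sum>k<n. y $ k)
    + (\<Sum>j<n. ((\<Sum>k<j. y $ k) - (\<Sum>k<i. y $ k)) * cyclic_drop A i j)"
proof -
  let ?z = "\<lambda>j. \<Sum>k<j. y $ k"
  have "(A *\<^sub>v y) $ i = (\<Sum>j<n. A $$ (i, j) * (?z (Suc j) - ?z j))"
    using A y i by (auto simp: scalar_prod_def lessThan_atLeast0 intro!: sum.cong)
  also have "\<dots> = A $$ (i, n - 1) * (?z n - ?z 0) + (\<Sum>j<n. ?z j * cyclic_drop A i j)"
    by (rule sum_cyclic_drop_mult[OF A]) (use i in simp)
  \<comment> \<open>Zero row sums allow the constant \<open>?z i\<close> to be subtracted.\<close>
  also have "(\<Sum>j<n. ?z j * cyclic_drop A i j) = (\<Sum>j<n. (?z j - ?z i) * cyclic_drop A i j)"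
    using sum_cyclic_drop[OF A, of i]
    by (simp add: left_diff_distrib sum_subtractf sum_distrib_left[symmetric])
  finally show ?thesis by simp
qed

text \<open>If the total were positive, then in the row \<open>i\<close> minimising the partial sums
  the generator term would be nonnegative and the other term positive, so
  \<open>A *\<^sub>v y\<close> could not vanish there.\<close>

lemma kernel_vec_sum_le_0:
  assumes A: "A \<in> carrier_mat n n" and gen: "unichain_generator n (cyclic_drop A)"
    and pos: "\<And>i j. i < n \<Longrightarrow> j < n \<Longrightarrow> A $$ (i, j) > 0"
    and y: "y \<in> carrier_vec n" "A *\<^sub>v y = 0\<^sub>v n"
  shows "(\<Sum>k<n. y $ k) \<le> 0"
proof (rule ccontr)
  assume S: "\<not> (\<Sum>k<n. y $ k) \<le> 0"
  then have n: "n > 0" by (cases n) auto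
  let ?z = "\<lambda>j. \<Sum>k<j. y $ k"
  have "Min (?z ` {..<n}) \<in> ?z ` {..<n}" using n by (intro Min_in) auto
  then obtain i where i: "i < n" and eq: "Min (?z ` {..<n}) = ?z i" by auto
  have min: "?z i \<le> ?z j" if "j < n" for j
    unfolding eq[symmetric] using that by auto
  have "(\<Sum>j<n. (?z j - ?z i) * cyclic_drop A i j) \<ge> 0"
  proof (rule sum_nonneg)
    fix j assume "j \<in> {..<n}"
    then show "(?z j - ?z i) * cyclic_drop A i j \<ge> 0"
      using min[of j] unichain_generator_offdiag_nonneg[OF gen i, of j] by (cases "i = j") auto
  qed
  moreover have "A $$ (i, n - 1) * (\<Sum>k<n. y $ k) > 0"
    using S pos[OF i, of "n - 1"] n by (intro mult_pos_pos) auto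
  ultimately show False using mult_mat_vec_cyclic_drop[OF A y(1) i] y(2) i by simp
qed

lemma det_nonzero_if_positive:
  assumes A: "A \<in> carrier_mat n n" and gen: "unichain_generator n (cyclic_drop A)"
    and pos: "\<And>i j. i < n \<Longrightarrow> j < n \<Longrightarrow> A $$ (i, j) > 0"
  shows "det A \<noteq> 0"
proof
  assume "det A = 0"
  then obtain y where y: "y \<in> carrier_vec n" "y \<noteq> 0\<^sub>v n" "A *\<^sub>v y = 0\<^sub>v n"
    using det_0_iff_vec_prod_zero[OF A] by auto
  have "A *\<^sub>v (- y) = 0\<^sub>v n"
    using y A by (auto simp: mult_mat_vec_def scalar_prod_def sum_negf vec_eq_iff)
  then have "(\<Sum>k<n. (- y) $ k) \<le> 0"
    using y by (intro kernel_vec_sum_le_0[OF A gen pos]) auto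
  moreover have "(\<Sum>k<n. (- y) $ k) = - (\<Sum>k<n. y $ k)"
    using y by (simp add: sum_negf[symmetric])
  \<comment> \<open>With the total gone, the kernel equation says that the partial sums of
    \<open>y\<close> are harmonic.\<close>
  ultimately have S: "(\<Sum>k<n. y $ k) = 0"
    using kernel_vec_sum_le_0[OF A gen pos y(1,3)] by simp
  let ?z = "\<lambda>j. \<Sum>k<j. y $ k"
  have "?z i = ?z j" if "i < n" "j < n" for i j
  proof (rule unichain_generator_harmonic_const[OF gen _ that])
    fix i assume "i < n"
    then show "(\<Sum>j<n. (?z j - ?z i) * cyclic_drop A i j) = 0"
      using mult_mat_vec_cyclic_drop[OF A y(1)] y(3) S by simp
  qed
  \<comment> \<open>The constant value is that of the empty sum \<open>?z 0\<close>; the index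
    \<open>j = n\<close> is covered by \<open>S\<close>.\<close>
  then have z0: "?z j = 0" if "j \<le> n" for j
    using S that by (cases "j = n") (force simp: sum.neutral)+
  have "y $ j = 0" if "j < n" for j
    using z0[of "Suc j"] z0[of j] that by simp
  then show False using y by (auto simp: vec_eq_iff)
qed

section \<open>Positivity of the determinant by continuity\<close>

lemma continuous_on_det:
  fixes M :: "real \<Rightarrow> real mat"
  assumes "\<And>s. M s \<in> carrier_mat n n"
    and "\<And>i j. i < n \<Longrightarrow> j < n \<Longrightarrow> continuous_on S (\<lambda>s. M s $$ (i, j))"
  shows "continuous_on S (\<lambda>s. det (M s))"
  unfolding det_def'[OF assms(1)]
  by (intro continuous_on_sum continuous_on_mult continuous_on_const continuous_on_prod assms(2))
    (auto dest: permutes_in_image)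

lemma det_pos_if_positive:
  assumes A: "A \<in> carrier_mat n n" and gen: "unichain_generator n (cyclic_drop A)"
    and pos: "\<And>i j. i < n \<Longrightarrow> j < n \<Longrightarrow> A $$ (i, j) > 0"
  shows "det A > 0"
proof (rule ccontr)
  assume "\<not> det A > 0"
  define M where "M s = mat n n (\<lambda>(i, j). (1 - s) * A $$ (i, j) + (if i = j then s else 0))" for s
  have M: "M s \<in> carrier_mat n n" for s by (simp add: M_def)
  have "continuous_on {0..1} (\<lambda>s. det (M s))"
  proof (rule continuous_on_det[OF M])
    fix i j assume "i < n" "j < n"
    then show "continuous_on {0..1} (\<lambda>s. M s $$ (i, j))"
      by (cases "i = j") (auto simp: M_def intro!: continuous_intros)
  qed
  moreover have "M 0 = A" "M 1 = 1\<^sub>m n" using A by (auto simp: M_def)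
  \<comment> \<open>The determinant is at most 0 at \<open>A\<close> and equals 1 at the identity,
    so it vanishes somewhere on the segment.\<close>
  ultimately obtain s where s: "0 \<le> s" "s \<le> 1" "det (M s) = 0"
    using IVT'[of "\<lambda>s. det (M s)" 0 0 1] \<open>\<not> det A > 0\<close> by auto
  have "s \<noteq> 1" using s \<open>M 1 = 1\<^sub>m n\<close> by auto
  then have s1: "s < 1" using s by simp
  \<comment> \<open>Off the diagonal the identity matrix has drops 0 or 1, so adding a multiple of
    it removes no edge.\<close>
  have drop: "cyclic_drop (M s) i j \<ge> (1 - s) * cyclic_drop A i j"
    if "i < n" "j < n" "i \<noteq> j" for i j
    using that s A by (auto simp: cyclic_drop_def M_def algebra_simps)
  have "unichain_generator n (cyclic_drop (M s))"
  proof (rule unichain_generator_mono[OF gen])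
    fix i j assume ij: "i < n" "j < n" "i \<noteq> j"
    have "(1 - s) * cyclic_drop A i j \<ge> 0"
      using unichain_generator_offdiag_nonneg[OF gen ij] s1 by simp
    then show "cyclic_drop (M s) i j \<ge> 0" using drop[OF ij] by linarith
    assume "cyclic_drop A i j > 0"
    then have "(1 - s) * cyclic_drop A i j > 0" using s1 by simp
    then show "cyclic_drop (M s) i j > 0" using drop[OF ij] by linarith
  qed (rule sum_cyclic_drop[OF M])
  then have "det (M s) \<noteq> 0"
  proof (rule det_nonzero_if_positive[OF M])
    fix i j assume "i < n" "j < n"
    then show "M s $$ (i, j) > 0"
      using pos s s1 by (auto simp: M_def intro!: add_pos_nonneg mult_pos_pos)
  qed
  then show False using s by simp
qed

section \<open>Rank-one updates of the determinant\<close>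

text \<open>The block matrix with rows \<open>1, - V\<close> and \<open>U, 1\<close> factors both as
  \<open>L * R\<close> and as \<open>R' * L\<close>, with all three factors block triangular and
  \<open>det L = 1\<close>.\<close>

lemma det_one_plus_rank_one:
  fixes U V :: "'a :: idom mat"
  assumes U: "U \<in> carrier_mat n 1" and V: "V \<in> carrier_mat 1 n"
  shows "det (1\<^sub>m n + U * V) = 1 + (V * U) $$ (0, 0)"
proof -
  define L where "L = four_block_mat (1\<^sub>m 1) (0\<^sub>m 1 n) U (1\<^sub>m n)"
  define R where "R = four_block_mat (1\<^sub>m 1) (- V) (0\<^sub>m n 1) (1\<^sub>m n + U * V)"
  define R' where "R' = four_block_mat (1\<^sub>m 1 + V * U) (- V) (0\<^sub>m n 1) (1\<^sub>m n)"
  have carr: "L \<in> carrier_mat (1 + n) (1 + n)" "R \<in> carrier_mat (1 + n) (1 + n)"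
    "R' \<in> carrier_mat (1 + n) (1 + n)"
    using U V unfolding L_def R_def R'_def by (intro four_block_carrier_mat; simp)+
  have [simp]: "U * - V = - (U * V)"
    using U V by (intro eq_matI) (auto simp: scalar_prod_def sum_negf)
  have [simp]: "- V * U = - (V * U)"
    using U V by (intro eq_matI) (auto simp: scalar_prod_def sum_negf)
  have [simp]: "- (U * V) + (1\<^sub>m n + U * V) = 1\<^sub>m n"
    using U V by (intro eq_matI) auto
  have [simp]: "1\<^sub>m 1 + V * U + - (V * U) = 1\<^sub>m 1"
    using U V by (intro eq_matI) auto
  have UV: "U * V \<in> carrier_mat n n" "V * U \<in> carrier_mat 1 1" using U V by auto
  have "L * R = four_block_mat (1\<^sub>m 1) (- V) U (1\<^sub>m n)"
    unfolding L_def R_def using U V UV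
    by (subst mult_four_block_mat[of _ 1 1 _ n _ n _ _ 1 _ n]) auto
  moreover have "R' * L = four_block_mat (1\<^sub>m 1) (- V) U (1\<^sub>m n)"
    unfolding L_def R'_def using U V UV
    by (subst mult_four_block_mat[of _ 1 1 _ n _ n _ _ 1 _ n]) auto
  ultimately have "det L * det R = det R' * det L"
    using det_mult[OF carr(1,2)] det_mult[OF carr(3,1)] by simp
  moreover have "det L = 1"
    unfolding L_def using U by (subst det_four_block_mat_upper_right_zero[of _ 1 _ n]) auto
  moreover have "det R = det (1\<^sub>m n + U * V)"
    unfolding R_def using V UV by (subst det_four_block_mat_lower_left_zero[of _ 1 _ n]) auto
  moreover have "det R' = det (1\<^sub>m 1 + V * U)"
    unfolding R'_def using V UV by (subst det_four_block_mat_lower_left_zero[of _ 1 _ n]) auto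
  moreover have "det (1\<^sub>m 1 + V * U) = 1 + (V * U) $$ (0, 0)"
    using U V UV by (subst det_single) auto
  ultimately show ?thesis by simp
qed

text \<open>The hypothesis says that the row vector \<open>V\<close> of the \<open>x i\<close>
  satisfies \<open>V * A = (1, ..., 1)\<close>. The constant matrix of entries \<open>t\<close> is
  therefore \<open>U * V * A\<close>, and \<open>A\<close> factors out on the right.\<close>

lemma det_add_const:
  fixes A :: "'a :: idom mat"
  assumes A: "A \<in> carrier_mat n n"
    and x: "\<And>j. j < n \<Longrightarrow> (\<Sum>i<n. x i * A $$ (i, j)) = 1"
  shows "det (mat n n (\<lambda>(i, j). A $$ (i, j) + t)) = (1 + t * (\<Sum>i<n. x i)) * det A"
proof -
  define U where "U = mat n 1 (\<lambda>_. t)"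
  define V where "V = mat 1 n (\<lambda>(_, j). x j)"
  have UV: "U \<in> carrier_mat n 1" "V \<in> carrier_mat 1 n" by (auto simp: U_def V_def)
  have "mat n n (\<lambda>(i, j). A $$ (i, j) + t) = A + U * (V * A)"
    using A x by (intro eq_matI) (auto simp: U_def V_def scalar_prod_def lessThan_atLeast0)
  also have "\<dots> = (1\<^sub>m n + U * V) * A"
    using A UV by (simp add: add_mult_distrib_mat[of _ n n] assoc_mult_mat[of _ n 1 _ n])
  also have "det \<dots> = det (1\<^sub>m n + U * V) * det A"
    using A UV by (intro det_mult) auto
  also have "det (1\<^sub>m n + U * V) = 1 + t * (\<Sum>i<n. x i)"
    unfolding det_one_plus_rank_one[OF UV]
    by (simp add: U_def V_def scalar_prod_def lessThan_atLeast0 sum_distrib_left mult.commute)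
  finally show ?thesis .
qed

section \<open>Combining the signs of the solution and the determinant\<close>

theorem theorem9:
  fixes A :: "real mat" and x :: "real vec" and n :: nat
  assumes "A \<in> carrier_mat n n"
    and "cyclically_nonincreasing_rows A"
    and "\<exists>!C. closed_scc (with_proj (matrix_digraph A)) C"
    and "x \<in> carrier_vec n"
    and "transpose_mat A *\<^sub>v x = vec n (\<lambda>_. 1)"
  shows "(x \<ge> 0\<^sub>v n \<and> det A > 0) \<or> (x \<le> 0\<^sub>v n \<and> det A < 0)"
proof -
  note A = assms(1) and x = assms(4)
  have gen: "unichain_generator n (cyclic_drop A)"
    by (rule unichain_generator_cyclic_drop[OF assms(1-3)])
  have col: "(\<Sum>i<n. x $ i * A $$ (i, j)) = 1" if "j < n" for j
  proof -
    have "(transpose_mat A *\<^sub>v x) $ j = 1" using assms(5) that by simp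
    then show ?thesis
      using A x that by (simp add: scalar_prod_def lessThan_atLeast0 mult.commute)
  qed
  \<comment> \<open>A graph without vertices has no component at all, let alone a closed
    one.\<close>
  have n: "n > 0"
  proof (rule ccontr)
    assume "\<not> n > 0"
    then have "out_closed n (cyclic_drop A) {} \<and> verts (with_proj (matrix_digraph A)) = {}"
      using A by (auto simp: out_closed_def matrix_digraph_def)
    moreover interpret G: wf_digraph "with_proj (matrix_digraph A)" by (rule wf_matrix_digraph)
    obtain C where "closed_scc (with_proj (matrix_digraph A)) C" using assms(3) by blast
    ultimately show False
      by (auto simp: closed_scc_def G.sccs_verts_eq_quotient quotient_def)
  qed
  define s where "s = (\<Sum>i<n. x $ i)"
  have sign: "(\<forall>i<n. x $ i \<ge> 0) \<or> (\<forall>i<n. x $ i \<le> 0)"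
  proof (rule unichain_generator_left_kernel_sign[OF gen])
    fix j assume j: "j < n"
    let ?j = "if j = 0 then dim_col A - 1 else j - 1"
    \<comment> \<open>Subtracting the equations of two cyclically adjacent columns puts
      \<open>x\<close> in the left kernel of the drops.\<close>
    have "?j < n" using A j by auto
    from col[OF this] col[OF j] show "(\<Sum>i<n. x $ i * cyclic_drop A i j) = 0"
      unfolding cyclic_drop_def right_diff_distrib sum_subtractf by simp
  qed
  \<comment> \<open>Entries of one sign with sum 0 all vanish, which contradicts the equation of
    column 0.\<close>
  have s0: "s \<noteq> 0"
  proof
    assume s: "s = 0"
    have "x $ i = 0" if "i < n" for i
      using sign
    proof
      assume "\<forall>i<n. x $ i \<ge> 0"
      then show ?thesis using s that unfolding s_def by (subst (asm) sum_nonneg_eq_0_iff) auto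
    next
      assume "\<forall>i<n. x $ i \<le> 0"
      moreover have "(\<Sum>i<n. - x $ i) = 0" using s by (simp add: s_def sum_negf)
      ultimately show ?thesis using that by (subst (asm) sum_nonneg_eq_0_iff) auto
    qed
    then show False using col[OF n] by simp
  qed
  have pos: "(1 + t * s) * det A > 0" if t: "\<And>i j. i < n \<Longrightarrow> j < n \<Longrightarrow> A $$ (i, j) + t > 0" for t
  proof -
    let ?M = "mat n n (\<lambda>(i, j). A $$ (i, j) + t)"
    have drop: "cyclic_drop ?M i j = cyclic_drop A i j" if "i < n" "j < n" for i j
      using that A by (auto simp: cyclic_drop_def)
    have "unichain_generator n (cyclic_drop ?M)"
    proof (rule unichain_generator_mono[OF gen])
      fix i show "(\<Sum>j<n. cyclic_drop ?M i j) = 0" by (rule sum_cyclic_drop) simp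
    qed (simp_all add: drop unichain_generator_offdiag_nonneg[OF gen])
    then have "0 < det ?M"
      using t by (intro det_pos_if_positive[of _ n]) auto
    also have "det ?M = (1 + t * s) * det A"
      unfolding s_def by (rule det_add_const[OF A col])
    finally show ?thesis .
  qed
  \<comment> \<open>The double sum makes every \<open>A $$ (i, j) + T\<close> positive; exceeding
    \<open>1 / \<bar>s\<bar>\<close> gives \<open>1 + T * s\<close> the sign of
    \<open>s\<close>.\<close>
  define T where "T = 1 / \<bar>s\<bar> + 1 + (\<Sum>i<n. \<Sum>j<n. \<bar>A $$ (i, j)\<bar>)"
  have "A $$ (i, j) + T > 0" if "i < n" "j < n" for i j
  proof -
    have "\<bar>A $$ (i, j)\<bar> \<le> (\<Sum>j<n. \<bar>A $$ (i, j)\<bar>)"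
      using that by (intro member_le_sum) auto
    also have "\<dots> \<le> (\<Sum>i<n. \<Sum>j<n. \<bar>A $$ (i, j)\<bar>)"
      using that by (intro member_le_sum[of i _ "\<lambda>i. \<Sum>j<n. \<bar>A $$ (i, j)\<bar>"]) (auto intro: sum_nonneg)
    finally have "\<bar>A $$ (i, j)\<bar> \<le> (\<Sum>i<n. \<Sum>j<n. \<bar>A $$ (i, j)\<bar>)" .
    moreover have "1 / \<bar>s\<bar> \<ge> 0" by simp
    ultimately show ?thesis unfolding T_def by linarith
  qed
  note det = pos[OF this]
  have "1 / \<bar>s\<bar> < T" by (simp add: T_def add_pos_nonneg sum_nonneg)
  then have T: "1 < T * \<bar>s\<bar>" using s0 by (simp add: divide_less_eq)
  show ?thesis
    using sign
  proof
    assume x0: "\<forall>i<n. x $ i \<ge> 0"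
    then have "s \<ge> 0" unfolding s_def by (intro sum_nonneg) auto
    then have "1 + T * s > 0" using T by simp
    then have "det A > 0" using det by (simp add: zero_less_mult_iff)
    then show ?thesis using x0 x by (auto simp: less_eq_vec_def)
  next
    assume x0: "\<forall>i<n. x $ i \<le> 0"
    then have "s \<le> 0" unfolding s_def by (intro sum_nonpos) auto
    then have "1 + T * s < 0" using T by simp
    then have "det A < 0" using det by (simp add: zero_less_mult_iff)
    then show ?thesis using x0 x by (auto simp: less_eq_vec_def)
  qed
qed

end
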